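(* Being conformally related is an equivalence relation on the class of intrinsic, quasi-strongly causal Lorentzian pre-length spaces. Here two such spaces $(X,d,\ll,\leq,\tau)$ and $(\widetilde X,\widetilde d,\widetilde\ll,\widetilde\leq,\widetilde\tau)$ are conformally related if there exist a homeomorphism $\iota\colon X\to\widetilde X$ and a continuous function $\Omega\colon X\to(0,+\infty)$ such that for all $p,q\in X$: $$p\ll q\iff\iota(p)\,\widetilde\ll\,\iota(q),\qquad p\leq q\iff\iota(p)\,\widetilde\leq\,\iota(q),\qquad \widetilde\tau(\iota(p),\iota(q))=\tau_\Omega(p,q).$$
   Context: A Lorentzian pre-length space $(X,d,\ll,\leq,\tau)$ consists of a set $X$, a metric $d$ on $X$, two transitive relations $\ll,\leq$ on $X$ with $\leq$ reflexive and $\ll$ contained in $\leq$, and a map $\tau\colon X\times X\to[0,+\infty]$ which is lower semicontinuous with respect to the topology of $d$, satisfies $\tau(x,z)\geq\tau(x,y)+\tau(y,z)$ whenever $x\leq y\leq z$, satisfies $\tau(x,y)=0$ if $x\not\leq y$, and satisfies $\tau(x,y)>0$ if and only if $x\ll y$. A curve is a continuous map from an interval into $X$. A non-constant curve $\gamma\colon I\to X$ is causal if $\gamma(t)\leq\gamma(s)$ for all $t<s$ in $I$. A causal curve from $x$ to $y$ is one defined on a compact interval, starting at $x$ and ending at $y$. For a continuous $\Omega\colon X\to(0,+\infty)$ and a causal curve $\gamma\colon[a,b]\to X$ put $$L_\Omega^\tau(\gamma):=\inf\Big\{\sum_{i=0}^{m-1}\max_{t\in[t_i,t_{i+1}]}\Omega(\gamma(t))\,\tau(\gamma(t_i),\gamma(t_{i+1}))\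 :\ a=t_0<\dots<t_m=b\Big\},$$ and let $L^\tau(\gamma)$ be the same quantity with $\Omega\equiv1$. Define $$\tau_\Omega(x,y):=\sup\big(\{0\}\cup\{L_\Omega^\tau(\gamma):\gamma\text{ a causal curve from }x\text{ to }y\}\big).$$ The space is intrinsic if $\tau(x,y)=\sup(\{0\}\cup\{L^\tau(\gamma):\gamma\text{ a causal curve from }x\text{ to }y\})$ for all $x,y\in X$. It is quasi-strongly causal if for every $x\in X$ and every neighbourhood $U$ of $x$ there is a neighbourhood $V\subseteq U$ of $x$ such that every causal curve $\gamma\colon[a,b]\to X$ with $\gamma(a),\gamma(b)\in V$ satisfies $\gamma([a,b])\subseteq U$. Homeomorphisms are with respect to the metric topologies of $d$ and $\widetilde d$. *)

theory Defs
  imports "HOL-Analysis.Analysis"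
begin

text \<open>
  The set \<open>X\<close> is a carrier inside the type, and the fields are constrained only on it, except
  that the library's locale \<open>Metric_space\<close> wants the distance nonnegative and symmetric everywhere;
  every metric on \<open>X\<close> extends to such a function.
\<close>

record 'a lorentzian_space =
  points :: "'a set"
  metric_fn :: "'a \<Rightarrow> 'a \<Rightarrow> real"
  chron :: "'a \<Rightarrow> 'a \<Rightarrow> bool"
  causal :: "'a \<Rightarrow> 'a \<Rightarrow> bool"
  time_sep :: "'a \<Rightarrow> 'a \<Rightarrow> ennreal"

definition space_topology :: "'a lorentzian_space \<Rightarrow> 'a topology" where
  "space_topology S = Metric_space.mtopology (points S) (metric_fn S)"

definition lower_semicontinuous_map :: "'a topology \<Rightarrow> ('a \<Rightarrow> ennreal) \<Rightarrow> bool" where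
  "lower_semicontinuous_map T f \<longleftrightarrow> (\<forall>c. openin T {x \<in> topspace T. c < f x})"

definition lorentzian_pre_length_space :: "'a lorentzian_space \<Rightarrow> bool" where
  "lorentzian_pre_length_space S \<longleftrightarrow>
     Metric_space (points S) (metric_fn S) \<and>
     transp_on (points S) (chron S) \<and>
     transp_on (points S) (causal S) \<and>
     reflp_on (points S) (causal S) \<and>
     (\<forall>x\<in>points S. \<forall>y\<in>points S. chron S x y \<longrightarrow> causal S x y) \<and>
     lower_semicontinuous_map (prod_topology (space_topology S) (space_topology S))
       (\<lambda>(x, y). time_sep S x y) \<and>
     (\<forall>x\<in>points S. \<forall>y\<in>points S. \<forall>z\<in>points S. causal S x y \<longrightarrow> causal S y z \<longrightarrow>
        time_sep S x z \<ge> time_sep S x y + time_sep S y z) \<and>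
     (\<forall>x\<in>points S. \<forall>y\<in>points S. \<not> causal S x y \<longrightarrow> time_sep S x y = 0) \<and>
     (\<forall>x\<in>points S. \<forall>y\<in>points S. time_sep S x y > 0 \<longleftrightarrow> chron S x y)"

definition causal_curve :: "'a lorentzian_space \<Rightarrow> real set \<Rightarrow> (real \<Rightarrow> 'a) \<Rightarrow> bool" where
  "causal_curve S I \<gamma> \<longleftrightarrow>
     is_interval I \<and>
     continuous_map (top_of_set I) (space_topology S) \<gamma> \<and>
     \<not> \<gamma> constant_on I \<and>
     (\<forall>t\<in>I. \<forall>s\<in>I. t < s \<longrightarrow> causal S (\<gamma> t) (\<gamma> s))"

text \<open>Being non-constant forces \<open>a < b\<close> here.\<close>

definition causal_curve_from_to ::
    "'a lorentzian_space \<Rightarrow> 'a \<Rightarrow> 'a \<Rightarrow> real \<Rightarrow> real \<Rightarrow> (real \<Rightarrow> 'a) \<Rightarrow> bool" where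
  "causal_curve_from_to S x y a b \<gamma> \<longleftrightarrow> causal_curve S {a..b} \<gamma> \<and> \<gamma> a = x \<and> \<gamma> b = y"

definition conformal_factor :: "'a lorentzian_space \<Rightarrow> ('a \<Rightarrow> real) \<Rightarrow> bool" where
  "conformal_factor S \<Omega> \<longleftrightarrow>
     continuous_map (space_topology S) euclideanreal \<Omega> \<and> (\<forall>x\<in>points S. \<Omega> x > 0)"

text \<open>
  The real supremum is the maximum of the paper's sums: it is attained, since \<open>\<Omega> \<circ> \<gamma>\<close> is
  continuous on a compact interval (\<open>Max\<close> is only meaningful for finite sets).
\<close>

definition weighted_length ::
    "'a lorentzian_space \<Rightarrow> ('a \<Rightarrow> real) \<Rightarrow> real \<Rightarrow> real \<Rightarrow> (real \<Rightarrow> 'a) \<Rightarrow> ennreal" where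
  "weighted_length S \<Omega> a b \<gamma> =
     Inf {\<Sum>i<m. ennreal (SUP s\<in>{t i..t (Suc i)}. \<Omega> (\<gamma> s)) * time_sep S (\<gamma> (t i)) (\<gamma> (t (Suc i)))
          | (m :: nat) (t :: nat \<Rightarrow> real). t 0 = a \<and> t m = b \<and> (\<forall>i<m. t i < t (Suc i))}"

definition curve_length ::
    "'a lorentzian_space \<Rightarrow> real \<Rightarrow> real \<Rightarrow> (real \<Rightarrow> 'a) \<Rightarrow> ennreal" where
  "curve_length S = weighted_length S (\<lambda>_. 1)"

definition conformal_time_sep ::
    "'a lorentzian_space \<Rightarrow> ('a \<Rightarrow> real) \<Rightarrow> 'a \<Rightarrow> 'a \<Rightarrow> ennreal" where
  "conformal_time_sep S \<Omega> x y =
     Sup ({0} \<union> {weighted_length S \<Omega> a b \<gamma> | a b \<gamma>. causal_curve_from_to S x y a b \<gamma>})"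

definition intrinsic :: "'a lorentzian_space \<Rightarrow> bool" where
  "intrinsic S \<longleftrightarrow>
     (\<forall>x\<in>points S. \<forall>y\<in>points S. time_sep S x y =
        Sup ({0} \<union> {curve_length S a b \<gamma> | a b \<gamma>. causal_curve_from_to S x y a b \<gamma>}))"

definition neighbourhood :: "'a topology \<Rightarrow> 'a \<Rightarrow> 'a set \<Rightarrow> bool" where
  "neighbourhood T x U \<longleftrightarrow> U \<subseteq> topspace T \<and> (\<exists>W. openin T W \<and> x \<in> W \<and> W \<subseteq> U)"

definition quasi_strongly_causal :: "'a lorentzian_space \<Rightarrow> bool" where
  "quasi_strongly_causal S \<longleftrightarrow>
     (\<forall>x\<in>points S. \<forall>U. neighbourhood (space_topology S) x U \<longrightarrow>
        (\<exists>V\<subseteq>U. neighbourhood (space_topology S) x V \<and>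
           (\<forall>a b \<gamma>. causal_curve S {a..b} \<gamma> \<longrightarrow> \<gamma> a \<in> V \<longrightarrow> \<gamma> b \<in> V \<longrightarrow> \<gamma> ` {a..b} \<subseteq> U)))"

definition intrinsic_qsc_space :: "'a lorentzian_space \<Rightarrow> bool" where
  "intrinsic_qsc_space S \<longleftrightarrow>
     lorentzian_pre_length_space S \<and> intrinsic S \<and> quasi_strongly_causal S"

definition conformally_related :: "'a lorentzian_space \<Rightarrow> 'b lorentzian_space \<Rightarrow> bool" where
  "conformally_related S S' \<longleftrightarrow>
     (\<exists>\<iota> \<Omega>. homeomorphic_map (space_topology S) (space_topology S') \<iota> \<and>
        conformal_factor S \<Omega> \<and>
        (\<forall>p\<in>points S. \<forall>q\<in>points S.
           (chron S p q \<longleftrightarrow> chron S' (\<iota> p) (\<iota> q)) \<and>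
           (causal S p q \<longleftrightarrow> causal S' (\<iota> p) (\<iota> q)) \<and>
           time_sep S' (\<iota> p) (\<iota> q) = conformal_time_sep S \<Omega> p q))"

end

theory Submission
  imports Defs
begin

text \<open>
  Reflexivity is the intrinsic property, read with the constant factor \<open>1\<close>. Symmetry and
  transitivity both follow from one cocycle rule: rescaling first by \<open>\<Omega>\<close> and then by \<open>\<Theta>\<close> is the
  same as rescaling by \<open>\<Omega> \<Theta>\<close>. For transitivity this is the claim; for symmetry take
  \<open>\<Theta> = 1 / \<Omega>\<close>, so that the double rescaling is the rescaling by \<open>1\<close>, which gives back \<open>\<tau>\<close> because
  the space is intrinsic.

  A homeomorphism that preserves and reflects \<open>\<le>\<close> matches the causal curves of the two spaces, so
  the cocycle rule (\<open>conformal_time_sep_transport\<close>) reduces to an equality of lengths of a single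
  causal curve \<open>\<gamma>\<close>: its \<open>\<Theta>\<close>-weighted length with respect to \<open>\<tau>\<^sub>\<Omega>\<close> is its
  \<open>\<Omega> \<Theta>\<close>-weighted length with respect to \<open>\<tau>\<close> (\<open>weighted_length_conformal_change\<close>).

  For \<open>\<ge>\<close>, a piece of \<open>\<gamma>\<close> over \<open>[s, t]\<close> competes in the supremum that defines
  \<open>\<tau>\<^sub>\<Omega> (\<gamma> s) (\<gamma> t)\<close>, so the term \<open>max \<Theta> * \<tau>\<^sub>\<Omega> (\<gamma> s) (\<gamma> t)\<close> of any sum dominates the
  \<open>\<Omega> \<Theta>\<close>-length of that piece, and the length is subadditive under concatenation. Only a piece on
  which \<open>\<gamma>\<close> is constant is not a competitor; its length vanishes because quasi-strong causality
  excludes causal loops, whence \<open>\<tau> x x = 0\<close> by intrinsicness.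

  For \<open>\<le>\<close>, fix \<open>r > 1\<close>. Around each point of \<open>\<gamma>\<close>, quasi-strong causality confines \<^emph>\<open>all\<close> causal
  curves with close endpoints to a region where \<open>\<Omega>\<close> is constant up to a factor \<open>r\<close>. Since the
  \<open>\<Omega>\<close>-length of a curve is at most \<open>max \<Omega>\<close> times \<open>\<tau>\<close> of its endpoints, \<open>\<tau>\<^sub>\<Omega>\<close> is there at most
  about \<open>r \<Omega> \<tau>\<close>, and the summands compare up to \<open>r\<^sup>2\<close>
  (\<open>segment_weight_locally_le\<close>). By the reverse triangle inequality the \<open>\<Omega> \<Theta>\<close>-length is additive
  in the interval, so compactness makes this local comparison global
  (\<open>partition_inf_le_if_locally_le\<close>); then let \<open>r\<close> tend to \<open>1\<close>.
\<close>

section \<open>Infima of sums over partitions\<close>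

definition is_partition :: "real \<Rightarrow> real \<Rightarrow> nat \<Rightarrow> (nat \<Rightarrow> real) \<Rightarrow> bool" where
  "is_partition a b m t \<longleftrightarrow> t 0 = a \<and> t m = b \<and> (\<forall>i<m. t i < t (Suc i))"

definition partition_inf :: "(real \<Rightarrow> real \<Rightarrow> ennreal) \<Rightarrow> real \<Rightarrow> real \<Rightarrow> ennreal" where
  "partition_inf w a b = Inf {\<Sum>i<m. w (t i) (t (Suc i)) | m t. is_partition a b m t}"

lemma is_partition_mono:
  assumes "is_partition a b m t" "i \<le> j" "j \<le> m"
  shows "t i \<le> t j"
  using assms(2,3)
proof (induction j rule: dec_induct)
  case (step n)
  then have "t n < t (Suc n)"
    using assms(1) by (simp add: is_partition_def)
  then show ?case using step by simp
qed simp

lemma partition_inf_le_sum: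
  assumes "is_partition a b m t"
  shows "partition_inf w a b \<le> (\<Sum>i<m. w (t i) (t (Suc i)))"
  unfolding partition_inf_def using assms by (intro Inf_lower) blast

lemma partition_inf_greatest:
  assumes "\<And>m t. is_partition a b m t \<Longrightarrow> x \<le> (\<Sum>i<m. w (t i) (t (Suc i)))"
  shows "x \<le> partition_inf w a b"
  unfolding partition_inf_def using assms by (intro Inf_greatest) blast

text \<open>
  For finite \<open>y\<close> the inequality is equivalent to a bound on \<open>x - y\<close>; subtraction fails to be adjoint
  to addition only at \<open>y = top\<close>, where the claim is trivial.
\<close>

lemma le_add_partition_inf:
  assumes "\<And>m t. is_partition a b m t \<Longrightarrow> x \<le> y + (\<Sum>i<m. w (t i) (t (Suc i)))"
  shows "x \<le> y + partition_inf w a b"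
proof (cases "y = top")
  case False
  have "x - y \<le> partition_inf w a b"
    using assms False by (intro partition_inf_greatest) (simp add: ennreal_minus_le_iff)
  then show ?thesis using False by (simp add: ennreal_minus_le_iff)
qed simp

lemma partition_inf_refl [simp]: "partition_inf w a a = 0"
  using partition_inf_le_sum[of a a 0 "\<lambda>_. a" w] by (simp add: is_partition_def)

lemma partition_inf_le_single:
  assumes "a < b"
  shows "partition_inf w a b \<le> w a b"
  using partition_inf_le_sum[of a b 1 "\<lambda>i. if i = 0 then a else b" w] assms
  by (simp add: is_partition_def)

lemma partition_inf_mono:
  assumes "\<And>s t. a \<le> s \<Longrightarrow> s < t \<Longrightarrow> t \<le> b \<Longrightarrow> w s t \<le> w' s t"
  shows "partition_inf w a b \<le> partition_inf w' a b"
proof (rule partition_inf_greatest)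
  fix m t assume P: "is_partition a b m t"
  have "partition_inf w a b \<le> (\<Sum>i<m. w (t i) (t (Suc i)))"
    by (rule partition_inf_le_sum[OF P])
  also have "\<dots> \<le> (\<Sum>i<m. w' (t i) (t (Suc i)))"
  proof (rule sum_mono)
    fix i assume "i \<in> {..<m}"
    then show "w (t i) (t (Suc i)) \<le> w' (t i) (t (Suc i))"
      using P is_partition_mono[OF P, of 0 i] is_partition_mono[OF P, of "Suc i" m]
      by (intro assms) (auto simp: is_partition_def)
  qed
  finally show "partition_inf w a b \<le> (\<Sum>i<m. w' (t i) (t (Suc i)))" .
qed

text \<open>
  A partition of \<open>[a, b]\<close> and one of \<open>[b, c]\<close> concatenate to a partition of \<open>[a, c]\<close>. If the three
  points are not in order, one of the pieces has no partition and the right-hand side is \<open>top\<close>.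
\<close>

lemma partition_inf_subadditive:
  "partition_inf w a c \<le> partition_inf w a b + partition_inf w b c"
proof -
  have concat: "partition_inf w a c
      \<le> (\<Sum>i<m. w (t i) (t (Suc i))) + (\<Sum>i<n. w (s i) (s (Suc i)))"
    if t: "is_partition a b m t" and s: "is_partition b c n s" for m t n s
  proof -
    define r where "r i = (if i < m then t i else s (i - m))" for i
    have tr: "r i = t i" if "i \<le> m" for i
      using that t s by (cases "i = m") (auto simp: r_def is_partition_def)
    have sr: "r (m + i) = s i" for i
      by (simp add: r_def)
    have "is_partition a c (m + n) r"
      unfolding is_partition_def
    proof (intro conjI allI impI)
      show "r 0 = a" "r (m + n) = c"
        using t s tr[of 0] sr[of n] by (auto simp: is_partition_def)
      fix i assume i: "i < m + n"
      show "r i < r (Suc i)"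
      proof (cases "i < m")
        case True
        then show ?thesis using tr[of i] tr[of "Suc i"] t by (auto simp: is_partition_def)
      next
        case False
        then show ?thesis using sr[of "i - m"] sr[of "Suc (i - m)"] s i
          by (auto simp: is_partition_def)
      qed
    qed
    then have "partition_inf w a c \<le> (\<Sum>i<m+n. w (r i) (r (Suc i)))"
      by (rule partition_inf_le_sum)
    also have "\<dots> = (\<Sum>i<m. w (r i) (r (Suc i))) + (\<Sum>i<n. w (r (m + i)) (r (Suc (m + i))))"
      by (induction n) (auto simp: add.assoc)
    also have "(\<Sum>i<m. w (r i) (r (Suc i))) = (\<Sum>i<m. w (t i) (t (Suc i)))"
      by (rule sum.cong) (auto simp: tr)
    also have "(\<Sum>i<n. w (r (m + i)) (r (Suc (m + i)))) = (\<Sum>i<n. w (s i) (s (Suc i)))"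
      using sr[of "Suc _"] by (simp add: sr)
    finally show ?thesis .
  qed
  have half: "partition_inf w a c \<le> partition_inf w a b + (\<Sum>i<n. w (s i) (s (Suc i)))"
    if "is_partition b c n s" for n s
    using le_add_partition_inf[of a b "partition_inf w a c" "\<Sum>i<n. w (s i) (s (Suc i))" w]
      concat[OF _ that]
    by (simp add: add.commute)
  show ?thesis
    by (rule le_add_partition_inf[OF half])
qed

text \<open>
  Together with \<open>partition_inf_subadditive\<close> and \<open>partition_inf_le_single\<close> this characterizes
  \<open>partition_inf w\<close> as the largest subadditive function of intervals below \<open>w\<close>
  that vanishes on degenerate intervals.
\<close>

lemma subadditive_le_partition_inf:
  assumes "g a a = 0"
    and sub: "\<And>s t. a \<le> s \<Longrightarrow> s \<le> t \<Longrightarrow> t \<le> b \<Longrightarrow> g a t \<le> g a s + g s t"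
    and le: "\<And>s t. a \<le> s \<Longrightarrow> s < t \<Longrightarrow> t \<le> b \<Longrightarrow> g s t \<le> w s t"
  shows "g a b \<le> partition_inf w a b"
proof (rule partition_inf_greatest)
  fix m t assume P: "is_partition a b m t"
  have "g a (t j) \<le> (\<Sum>i<j. w (t i) (t (Suc i)))" if "j \<le> m" for j
    using that
  proof (induction j)
    case 0
    then show ?case using P assms(1) by (simp add: is_partition_def)
  next
    case (Suc j)
    have ord: "a \<le> t j" "t j < t (Suc j)" "t (Suc j) \<le> b"
      using P Suc.prems is_partition_mono[OF P, of 0 j] is_partition_mono[OF P, of "Suc j" m]
      by (auto simp: is_partition_def)
    have "g a (t (Suc j)) \<le> g a (t j) + g (t j) (t (Suc j))"
      using ord by (intro sub) auto
    also have "\<dots> \<le> (\<Sum>i<j. w (t i) (t (Suc i))) + w (t j) (t (Suc j))"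
      using Suc ord by (intro add_mono le) auto
    finally show ?case by simp
  qed
  from this[of m] show "g a b \<le> (\<Sum>i<m. w (t i) (t (Suc i)))"
    using P by (simp add: is_partition_def)
qed

text \<open>
  When \<open>w\<close> itself satisfies the reverse triangle inequality, inserting \<open>b\<close> into a partition of
  \<open>[a, c]\<close> does not increase the sum, so partitions through \<open>b\<close> suffice. The induction runs over
  the initial part of the partition: the interval that contains \<open>b\<close> is split there, and the later
  ones are appended.
\<close>

lemma partition_inf_superadditive:
  assumes super: "\<And>s t u. a \<le> s \<Longrightarrow> s < t \<Longrightarrow> t < u \<Longrightarrow> u \<le> c \<Longrightarrow> w s t + w t u \<le> w s u"
    and "a \<le> b" "b \<le> c"
  shows "partition_inf w a b + partition_inf w b c \<le> partition_inf w a c"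
proof (rule partition_inf_greatest)
  fix m t assume P: "is_partition a c m t"
  have "partition_inf w a b + partition_inf w b (t j) \<le> (\<Sum>i<j. w (t i) (t (Suc i)))"
    if "j \<le> m" "b \<le> t j" for j
    using that
  proof (induction j)
    case 0
    then show ?case using P \<open>a \<le> b\<close> by (simp add: is_partition_def)
  next
    case (Suc j)
    have ord: "a \<le> t j" "t j < t (Suc j)" "t (Suc j) \<le> c"
      using P Suc.prems is_partition_mono[OF P, of 0 j] is_partition_mono[OF P, of "Suc j" m]
      by (auto simp: is_partition_def)
    have Pj: "is_partition a (t j) j t"
      using P Suc.prems by (simp add: is_partition_def)
    note last = partition_inf_le_single[OF ord(2), of w]
    show ?case
    proof (cases "b \<le> t j")
      case True
      have "partition_inf w a b + partition_inf w b (t (Suc j))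
          \<le> partition_inf w a b + (partition_inf w b (t j) + partition_inf w (t j) (t (Suc j)))"
        by (intro add_left_mono partition_inf_subadditive)
      also have "\<dots> = (partition_inf w a b + partition_inf w b (t j)) + partition_inf w (t j) (t (Suc j))"
        by (simp add: add.assoc)
      also have "\<dots> \<le> (\<Sum>i<j. w (t i) (t (Suc i))) + w (t j) (t (Suc j))"
        using True Suc last by (intro add_mono) auto
      finally show ?thesis by simp
    next
      case False
      have last': "partition_inf w (t j) b + partition_inf w b (t (Suc j)) \<le> w (t j) (t (Suc j))"
      proof (cases "b = t (Suc j)")
        case True
        then show ?thesis using last by simp
      next
        case b: False
        have "partition_inf w (t j) b + partition_inf w b (t (Suc j)) \<le> w (t j) b + w b (t (Suc j))"
          using False b Suc.prems by (intro add_mono partition_inf_le_single) auto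
        also have "\<dots> \<le> w (t j) (t (Suc j))"
          using False b Suc.prems ord by (intro super) auto
        finally show ?thesis .
      qed
      have "partition_inf w a b
          \<le> (\<Sum>i<j. w (t i) (t (Suc i))) + partition_inf w (t j) b"
        using partition_inf_subadditive[of w a b "t j"] partition_inf_le_sum[OF Pj, of w]
        by (meson add_right_mono order_trans)
      then have "partition_inf w a b + partition_inf w b (t (Suc j))
          \<le> (\<Sum>i<j. w (t i) (t (Suc i))) + (partition_inf w (t j) b + partition_inf w b (t (Suc j)))"
        by (simp add: add_right_mono flip: add.assoc)
      also have "\<dots> \<le> (\<Sum>i<j. w (t i) (t (Suc i))) + w (t j) (t (Suc j))"
        by (intro add_left_mono last')
      finally show ?thesis by simp
    qed
  qed
  from this[of m] show "partition_inf w a b + partition_inf w b c \<le> (\<Sum>i<m. w (t i) (t (Suc i)))"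
    using P \<open>b \<le> c\<close> by (simp add: is_partition_def)
qed

text \<open>
  One inequality holds for every constant; the other is that inequality for \<open>1 / k\<close>.
\<close>

lemma partition_inf_cmult:
  assumes "k > 0"
  shows "partition_inf (\<lambda>s t. ennreal k * w s t) a b = ennreal k * partition_inf w a b"
proof (rule antisym)
  have le: "ennreal c * partition_inf v a b \<le> partition_inf (\<lambda>s t. ennreal c * v s t) a b" for c v
    by (rule partition_inf_greatest)
       (simp add: mult_left_mono partition_inf_le_sum flip: sum_distrib_left)
  have inv: "ennreal (1/k) * (ennreal k * x) = x" "ennreal k * (ennreal (1/k) * x) = x" for x
    using assms by (auto simp flip: mult.assoc ennreal_mult')
  show "ennreal k * partition_inf w a b \<le> partition_inf (\<lambda>s t. ennreal k * w s t) a b"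
    by (rule le)
  have "ennreal (1/k) * partition_inf (\<lambda>s t. ennreal k * w s t) a b \<le> partition_inf w a b"
    using le[of "1/k" "\<lambda>s t. ennreal k * w s t"] by (simp add: inv)
  then have "ennreal k * (ennreal (1/k) * partition_inf (\<lambda>s t. ennreal k * w s t) a b)
      \<le> ennreal k * partition_inf w a b"
    by (rule mult_left_mono) simp
  then show "partition_inf (\<lambda>s t. ennreal k * w s t) a b \<le> ennreal k * partition_inf w a b"
    by (simp add: inv)
qed

text \<open>
  The compactness step. The inequality between the two infima on a subinterval passes to the union
  of adjacent subintervals, since the left infimum is subadditive and the right one superadditive;
  and it holds on all short intervals around each point, so Bolzano's bisection principle applies.
\<close>

lemma partition_inf_le_if_locally_le:
  assumes "a \<le> b"
    and super: "\<And>s t u. a \<le> s \<Longrightarrow> s < t \<Longrightarrow> t < u \<Longrightarrow> u \<le> b \<Longrightarrow> w s t + w t u \<le> w s u"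
    and loc: "\<And>x. a \<le> x \<Longrightarrow> x \<le> b \<Longrightarrow>
      \<exists>d>0. \<forall>s t. a \<le> s \<and> s < t \<and> t \<le> b \<and> x - d < s \<and> t < x + d \<longrightarrow> v s t \<le> w s t"
  shows "partition_inf v a b \<le> partition_inf w a b"
proof -
  define P where "P c e \<longleftrightarrow> (a \<le> c \<longrightarrow> e \<le> b \<longrightarrow> partition_inf v c e \<le> partition_inf w c e)" for c e
  have "P a b"
    using \<open>a \<le> b\<close>
  proof (induction rule: Bolzano)
    case (trans c e f)
    show ?case
      unfolding P_def
    proof (intro impI)
      assume *: "a \<le> c" "f \<le> b"
      have "partition_inf v c f \<le> partition_inf v c e + partition_inf v e f"
        by (rule partition_inf_subadditive)
      also have "\<dots> \<le> partition_inf w c e + partition_inf w e f"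
        using trans * by (intro add_mono) (auto simp: P_def)
      also have "\<dots> \<le> partition_inf w c f"
        using trans * by (intro partition_inf_superadditive super) auto
      finally show "partition_inf v c f \<le> partition_inf w c f" .
    qed
  next
    case (local x)
    obtain d where d: "d > 0"
      "\<And>s t. a \<le> s \<Longrightarrow> s < t \<Longrightarrow> t \<le> b \<Longrightarrow> x - d < s \<Longrightarrow> t < x + d \<Longrightarrow> v s t \<le> w s t"
      using loc[OF local] by blast
    show ?case
      using d(1) by (intro exI[of _ d]) (auto simp: P_def intro!: partition_inf_mono d(2))
  qed
  then show ?thesis by (simp add: P_def)
qed

lemma ennreal_le_if_le_mult_greater_1:
  fixes x y :: ennreal
  assumes "\<And>r::real. r > 1 \<Longrightarrow> x \<le> ennreal (r * r) * y"
  shows "x \<le> y"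
proof (rule tendsto_lowerbound)
  show "((\<lambda>r. ennreal (r * r) * y) \<longlongrightarrow> y) (at_right 1)"
  proof (cases "y = top")
    case True
    have "eventually (\<lambda>r. ennreal (r * r) * y = y) (at_right 1)"
      using eventually_at_right_less[of "1::real"]
      by eventually_elim (auto simp: True ennreal_mult_top)
    then show ?thesis by (rule tendsto_eventually)
  next
    case False
    have "((\<lambda>r. ennreal (r * r)) \<longlongrightarrow> ennreal (1 * 1)) (at_right 1)"
      by (intro tendsto_intros)
    from ennreal_tendsto_cmult[OF _ this, of y] False show ?thesis
      by (simp add: mult.commute top.not_eq_extremum)
  qed
  show "eventually (\<lambda>r. x \<le> ennreal (r * r) * y) (at_right 1)"
    using eventually_at_right_less[of "1::real"] by eventually_elim (rule assms)
qed simp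

section \<open>Weighted lengths of causal curves\<close>

definition segment_weight ::
    "'a lorentzian_space \<Rightarrow> ('a \<Rightarrow> real) \<Rightarrow> (real \<Rightarrow> 'a) \<Rightarrow> real \<Rightarrow> real \<Rightarrow> ennreal" where
  "segment_weight S \<Omega> \<gamma> s t = ennreal (SUP u\<in>{s..t}. \<Omega> (\<gamma> u)) * time_sep S (\<gamma> s) (\<gamma> t)"

lemma weighted_length_eq: "weighted_length S \<Omega> a b \<gamma> = partition_inf (segment_weight S \<Omega> \<gamma>) a b"
  unfolding weighted_length_def partition_inf_def segment_weight_def is_partition_def ..

lemma weighted_length_cong:
  assumes "\<And>u. u \<in> {a..b} \<Longrightarrow> \<Omega> (\<gamma> u) = \<Omega>' (\<gamma>' u)"
    and "\<And>s t. s \<in> {a..b} \<Longrightarrow> t \<in> {a..b} \<Longrightarrow> time_sep S (\<gamma> s) (\<gamma> t) = time_sep S' (\<gamma>' s) (\<gamma>' t)"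
  shows "weighted_length S \<Omega> a b \<gamma> = weighted_length S' \<Omega>' a b \<gamma>'"
proof -
  have "segment_weight S \<Omega> \<gamma> s t = segment_weight S' \<Omega>' \<gamma>' s t" if "a \<le> s" "s < t" "t \<le> b" for s t
  proof -
    have "(SUP u\<in>{s..t}. \<Omega> (\<gamma> u)) = (SUP u\<in>{s..t}. \<Omega>' (\<gamma>' u))"
      using that assms(1) by (intro SUP_cong) auto
    then show ?thesis
      using that assms(2) by (simp add: segment_weight_def)
  qed
  then show ?thesis
    unfolding weighted_length_eq by (intro antisym partition_inf_mono) auto
qed

lemma topspace_space_topology:
  assumes "lorentzian_pre_length_space S"
  shows "topspace (space_topology S) = points S"
  using assms unfolding lorentzian_pre_length_space_def space_topology_def
  by (simp add: Metric_space.topspace_mtopology)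

lemma conformal_factor_mult:
  assumes "conformal_factor S \<Omega>" "conformal_factor S \<Theta>"
  shows "conformal_factor S (\<lambda>x. \<Omega> x * \<Theta> x)"
  using assms by (auto simp: conformal_factor_def intro: continuous_map_real_mult)

context
  fixes S :: "'a lorentzian_space"
  assumes S: "intrinsic_qsc_space S"
begin

lemma lpls: "lorentzian_pre_length_space S"
  using S by (simp add: intrinsic_qsc_space_def)

lemma topspace_eq [simp]: "topspace (space_topology S) = points S"
  by (rule topspace_space_topology[OF lpls])

lemma causal_curve_in_points:
  assumes "causal_curve S I \<gamma>" "u \<in> I"
  shows "\<gamma> u \<in> points S"
  using assms continuous_map_image_subset_topspace[of "top_of_set I" "space_topology S" \<gamma>]
  by (auto simp: causal_curve_def)

lemma causal_curve_subinterval: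
  assumes "causal_curve S {a..b} \<gamma>" "{s..t} \<subseteq> {a..b}" "\<not> \<gamma> constant_on {s..t}"
  shows "causal_curve S {s..t} \<gamma>"
  using assms unfolding causal_curve_def
  by (auto intro: continuous_map_from_subtopology_mono is_interval_cc)

lemma bdd_above_factor_image:
  assumes "causal_curve S {a..b} \<gamma>" "conformal_factor S \<Omega>" "{s..t} \<subseteq> {a..b}"
  shows "bdd_above ((\<lambda>u. \<Omega> (\<gamma> u)) ` {s..t})"
proof -
  have "continuous_map (top_of_set {a..b}) euclideanreal (\<Omega> \<circ> \<gamma>)"
    using assms(1,2) unfolding causal_curve_def conformal_factor_def
    by (intro continuous_map_compose[of _ "space_topology S"]) auto
  then have "continuous_on {a..b} (\<lambda>u. \<Omega> (\<gamma> u))"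
    by (simp add: o_def)
  then have "compact ((\<lambda>u. \<Omega> (\<gamma> u)) ` {a..b})"
    by (intro compact_continuous_image) auto
  then have "bdd_above ((\<lambda>u. \<Omega> (\<gamma> u)) ` {a..b})"
    by (intro bounded_imp_bdd_above compact_imp_bounded)
  then show ?thesis
    by (rule bdd_above_mono) (use assms in auto)
qed

lemma le_factor_SUP:
  assumes "causal_curve S {a..b} \<gamma>" "conformal_factor S \<Omega>" "{s..t} \<subseteq> {a..b}" "u \<in> {s..t}"
  shows "\<Omega> (\<gamma> u) \<le> (SUP u\<in>{s..t}. \<Omega> (\<gamma> u))"
  using bdd_above_factor_image[OF assms(1-3)] assms(4) by (rule cSUP_upper2[OF _ _ order_refl])

lemma factor_pos:
  assumes "causal_curve S {a..b} \<gamma>" "conformal_factor S \<Omega>" "u \<in> {a..b}"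
  shows "0 < \<Omega> (\<gamma> u)"
  using causal_curve_in_points[OF assms(1,3)] assms(2) by (auto simp: conformal_factor_def)

lemma factor_SUP_pos:
  assumes "causal_curve S {a..b} \<gamma>" "conformal_factor S \<Omega>" "{s..t} \<subseteq> {a..b}" "s \<le> t"
  shows "0 < (SUP u\<in>{s..t}. \<Omega> (\<gamma> u))"
  using factor_pos[OF assms(1,2), of s] le_factor_SUP[OF assms(1-3), of s] assms(3,4) by auto

lemma segment_weight_superadditive:
  assumes \<gamma>: "causal_curve S {a..b} \<gamma>" and \<Omega>: "conformal_factor S \<Omega>"
    and ord: "a \<le> s" "s < t" "t < u" "u \<le> b"
  shows "segment_weight S \<Omega> \<gamma> s t + segment_weight S \<Omega> \<gamma> t u \<le> segment_weight S \<Omega> \<gamma> s u"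
proof -
  let ?M = "\<lambda>s t. ennreal (SUP u\<in>{s..t}. \<Omega> (\<gamma> u))"
  have M: "?M s t \<le> ?M s u" "?M t u \<le> ?M s u"
    using ord by (auto intro!: ennreal_leI cSUP_subset_mono bdd_above_factor_image[OF \<gamma> \<Omega>])
  have pts: "\<gamma> s \<in> points S" "\<gamma> t \<in> points S" "\<gamma> u \<in> points S"
    using ord by (auto intro: causal_curve_in_points[OF \<gamma>])
  have "causal S (\<gamma> s) (\<gamma> t)" "causal S (\<gamma> t) (\<gamma> u)"
    using \<gamma> ord by (auto simp: causal_curve_def)
  then have rev: "time_sep S (\<gamma> s) (\<gamma> t) + time_sep S (\<gamma> t) (\<gamma> u) \<le> time_sep S (\<gamma> s) (\<gamma> u)"
    using lpls pts by (auto simp: lorentzian_pre_length_space_def)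
  have "segment_weight S \<Omega> \<gamma> s t + segment_weight S \<Omega> \<gamma> t u
      \<le> ?M s u * time_sep S (\<gamma> s) (\<gamma> t) + ?M s u * time_sep S (\<gamma> t) (\<gamma> u)"
    unfolding segment_weight_def using M by (intro add_mono mult_right_mono) auto
  also have "\<dots> \<le> ?M s u * time_sep S (\<gamma> s) (\<gamma> u)"
    using rev by (simp add: mult_left_mono flip: distrib_left)
  finally show ?thesis
    by (simp add: segment_weight_def)
qed

lemma quasi_strongly_causal_neighbourhood:
  assumes "neighbourhood (space_topology S) x U" "x \<in> points S"
  shows "\<exists>V\<subseteq>U. neighbourhood (space_topology S) x V \<and>
    (\<forall>a b \<gamma>. causal_curve S {a..b} \<gamma> \<longrightarrow> \<gamma> a \<in> V \<longrightarrow> \<gamma> b \<in> V \<longrightarrow> \<gamma> ` {a..b} \<subseteq> U)"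
  using S assms unfolding intrinsic_qsc_space_def quasi_strongly_causal_def by simp

text \<open>
  A causal loop at \<open>x\<close> leaves the neighbourhood that omits one of its other points, while both its
  endpoints lie in every neighbourhood of \<open>x\<close>.
\<close>

lemma no_causal_loop:
  assumes \<gamma>: "causal_curve S {a..b} \<gamma>"
  shows "\<gamma> a \<noteq> \<gamma> b"
proof
  assume eq: "\<gamma> a = \<gamma> b"
  obtain u where u: "u \<in> {a..b}" "\<gamma> u \<noteq> \<gamma> a"
    using \<gamma> unfolding causal_curve_def constant_on_def by metis
  have a: "\<gamma> a \<in> points S"
    using u(1) by (intro causal_curve_in_points[OF \<gamma>]) auto
  have "Metric_space (points S) (metric_fn S)"
    using lpls by (simp add: lorentzian_pre_length_space_def)
  then have "t1_space (space_topology S)"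
    unfolding space_topology_def by (intro Hausdorff_imp_t1_space Metric_space.Hausdorff_space_mtopology)
  then have "openin (space_topology S) (points S - {\<gamma> u})"
    using causal_curve_in_points[OF \<gamma> u(1)] by (metis t1_space_openin_delete_alt openin_topspace topspace_eq)
  then have "neighbourhood (space_topology S) (\<gamma> a) (points S - {\<gamma> u})"
    using a u(2) by (auto simp: neighbourhood_def)
  then obtain V where V: "neighbourhood (space_topology S) (\<gamma> a) V"
    "\<And>a' b' \<eta>. causal_curve S {a'..b'} \<eta> \<Longrightarrow> \<eta> a' \<in> V \<Longrightarrow> \<eta> b' \<in> V \<Longrightarrow> \<eta> ` {a'..b'} \<subseteq> points S - {\<gamma> u}"
    using quasi_strongly_causal_neighbourhood[OF _ a] by meson
  have "\<gamma> a \<in> V" using V(1) by (auto simp: neighbourhood_def)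
  then have "\<gamma> ` {a..b} \<subseteq> points S - {\<gamma> u}"
    using \<gamma> eq by (intro V(2)) auto
  then have "\<gamma> u \<noteq> \<gamma> u" using u(1) by blast
  then show False by simp
qed

lemma time_sep_refl_eq_0:
  assumes "x \<in> points S"
  shows "time_sep S x x = 0"
proof -
  have "time_sep S x x = Sup ({0} \<union> {curve_length S a b \<gamma> | a b \<gamma>. causal_curve_from_to S x x a b \<gamma>})"
    using S assms by (auto simp: intrinsic_qsc_space_def intrinsic_def)
  also have "{curve_length S a b \<gamma> | a b \<gamma>. causal_curve_from_to S x x a b \<gamma>} = {}"
    by (auto simp: causal_curve_from_to_def dest: no_causal_loop)
  finally show ?thesis by simp
qed

text \<open>
  The partition with a single interval bounds the length of a causal curve by its largest weight
  times the time separation of its endpoints.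
\<close>

lemma conformal_time_sep_le:
  assumes "\<And>a b \<eta> u. causal_curve_from_to S x y a b \<eta> \<Longrightarrow> u \<in> {a..b} \<Longrightarrow> \<Omega> (\<eta> u) \<le> C"
  shows "conformal_time_sep S \<Omega> x y \<le> ennreal C * time_sep S x y"
  unfolding conformal_time_sep_def
proof (rule Sup_least)
  fix z assume z_mem: "z \<in> {0} \<union> {weighted_length S \<Omega> a b \<eta> | a b \<eta>. causal_curve_from_to S x y a b \<eta>}"
  show "z \<le> ennreal C * time_sep S x y"
  proof (cases "z = 0")
    case False
    then obtain a b \<eta> where z: "z = weighted_length S \<Omega> a b \<eta>" and \<eta>: "causal_curve_from_to S x y a b \<eta>"
      using z_mem by auto
    have "a < b"
    proof (rule ccontr)
      assume "\<not> a < b"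
      then have "u = a" if "u \<in> {a..b}" for u
        using that by auto
      then have "\<eta> constant_on {a..b}"
        unfolding constant_on_def by blast
      then show False using \<eta> by (auto simp: causal_curve_from_to_def causal_curve_def)
    qed
    then have "z \<le> segment_weight S \<Omega> \<eta> a b"
      unfolding z weighted_length_eq by (rule partition_inf_le_single)
    also have "\<dots> \<le> ennreal C * time_sep S x y"
      unfolding segment_weight_def using \<eta> assms[OF \<eta>] \<open>a < b\<close>
      by (auto simp: causal_curve_from_to_def intro!: mult_mono ennreal_leI cSUP_least)
    finally show ?thesis .
  qed simp
qed

lemma weighted_length_le_conformal_time_sep:
  assumes "causal_curve_from_to S x y a b \<gamma>"
  shows "weighted_length S \<Omega> a b \<gamma> \<le> conformal_time_sep S \<Omega> x y"
  unfolding conformal_time_sep_def using assms by (intro Sup_upper) blast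

text \<open>
  The curve on \<open>[s, t]\<close> is a competitor in the supremum \<open>\<tau>\<^sub>\<Omega> (\<gamma> s) (\<gamma> t)\<close>, and
  \<open>max (\<Omega> \<Theta>) \<le> max \<Omega> * max \<Theta>\<close>. If it is constant there, it is not a causal curve, and the left-hand
  side vanishes instead.
\<close>

lemma weighted_length_product_le_segment:
  assumes \<gamma>: "causal_curve S {a..b} \<gamma>" and \<Omega>: "conformal_factor S \<Omega>" and \<Theta>: "conformal_factor S \<Theta>"
    and ord: "a \<le> s" "s < t" "t \<le> b"
  shows "weighted_length S (\<lambda>x. \<Omega> x * \<Theta> x) s t \<gamma>
    \<le> segment_weight (S\<lparr>time_sep := conformal_time_sep S \<Omega>\<rparr>) \<Theta> \<gamma> s t"
proof (cases "\<gamma> constant_on {s..t}")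
  case True
  then have eq: "\<gamma> s = \<gamma> t"
    using ord by (auto simp: constant_on_def)
  have "weighted_length S (\<lambda>x. \<Omega> x * \<Theta> x) s t \<gamma> \<le> segment_weight S (\<lambda>x. \<Omega> x * \<Theta> x) \<gamma> s t"
    unfolding weighted_length_eq using ord by (intro partition_inf_le_single)
  also have "\<dots> = 0"
    using ord causal_curve_in_points[OF \<gamma>, of t]
    by (simp add: segment_weight_def eq time_sep_refl_eq_0)
  finally show ?thesis by simp
next
  case False
  define M where "M = (SUP u\<in>{s..t}. \<Theta> (\<gamma> u))"
  have M: "M > 0"
    unfolding M_def using ord by (intro factor_SUP_pos[OF \<gamma> \<Theta>]) auto
  have "segment_weight S (\<lambda>x. \<Omega> x * \<Theta> x) \<gamma> p q \<le> ennreal M * segment_weight S \<Omega> \<gamma> p q"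
    if pq: "s \<le> p" "p < q" "q \<le> t" for p q
  proof -
    have "(SUP u\<in>{p..q}. \<Omega> (\<gamma> u) * \<Theta> (\<gamma> u)) \<le> M * (SUP u\<in>{p..q}. \<Omega> (\<gamma> u))"
    proof (rule cSUP_least)
      fix u assume u: "u \<in> {p..q}"
      have "\<Theta> (\<gamma> u) * \<Omega> (\<gamma> u) \<le> M * (SUP u\<in>{p..q}. \<Omega> (\<gamma> u))"
      proof (rule mult_mono)
        show "\<Theta> (\<gamma> u) \<le> M" unfolding M_def
          using u pq ord by (intro le_factor_SUP[OF \<gamma> \<Theta>]) auto
        show "\<Omega> (\<gamma> u) \<le> (SUP u\<in>{p..q}. \<Omega> (\<gamma> u))"
          using u pq ord by (intro le_factor_SUP[OF \<gamma> \<Omega>]) auto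
      qed (use M factor_pos[OF \<gamma> \<Omega>, of u] u pq ord in auto)
      then show "\<Omega> (\<gamma> u) * \<Theta> (\<gamma> u) \<le> M * (SUP u\<in>{p..q}. \<Omega> (\<gamma> u))"
        by (simp add: mult.commute)
    qed (use pq in auto)
    then show ?thesis
      unfolding segment_weight_def using M
      by (auto simp: ennreal_mult' simp flip: mult.assoc intro!: mult_right_mono dest: ennreal_leI)
  qed
  then have "weighted_length S (\<lambda>x. \<Omega> x * \<Theta> x) s t \<gamma>
      \<le> partition_inf (\<lambda>p q. ennreal M * segment_weight S \<Omega> \<gamma> p q) s t"
    unfolding weighted_length_eq by (rule partition_inf_mono)
  also have "\<dots> = ennreal M * weighted_length S \<Omega> s t \<gamma>"
    unfolding weighted_length_eq by (rule partition_inf_cmult[OF M])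
  also have "\<dots> \<le> ennreal M * conformal_time_sep S \<Omega> (\<gamma> s) (\<gamma> t)"
    using False ord
    by (intro mult_left_mono weighted_length_le_conformal_time_sep)
       (auto simp: causal_curve_from_to_def intro!: causal_curve_subinterval[OF \<gamma>])
  finally show ?thesis
    by (simp add: segment_weight_def M_def)
qed

text \<open>
  Near \<open>x\<close> the points of the curve lie in the neighbourhood \<open>V\<close> of \<open>p = \<gamma> x\<close> that quasi-strong
  causality provides for the region \<open>U\<close> where \<open>\<Omega>\<close> is within a factor \<open>r\<close> of \<open>\<Omega> p\<close>. One factor \<open>r\<close>
  is lost in passing from the competing curves to \<open>p\<close>, the other in passing from \<open>p\<close> to \<open>\<gamma>\<close>.
\<close>

lemma segment_weight_locally_le:
  assumes \<gamma>: "causal_curve S {a..b} \<gamma>" and \<Omega>: "conformal_factor S \<Omega>" and \<Theta>: "conformal_factor S \<Theta>"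
    and \<Omega>\<Theta>: "conformal_factor S (\<lambda>x. \<Omega> x * \<Theta> x)"
    and x: "a \<le> x" "x \<le> b" and r: "r > 1"
  shows "\<exists>d>0. \<forall>s t. a \<le> s \<and> s < t \<and> t \<le> b \<and> x - d < s \<and> t < x + d \<longrightarrow>
    segment_weight (S\<lparr>time_sep := conformal_time_sep S \<Omega>\<rparr>) \<Theta> \<gamma> s t
      \<le> ennreal (r * r) * segment_weight S (\<lambda>x. \<Omega> x * \<Theta> x) \<gamma> s t"
proof -
  define p where "p = \<gamma> x"
  have p: "p \<in> points S"
    unfolding p_def using x by (intro causal_curve_in_points[OF \<gamma>]) auto
  then have \<Omega>p: "\<Omega> p > 0"
    using \<Omega> by (auto simp: conformal_factor_def)
  \<comment> \<open>Both bounds matter: the upper one for the competing curves, the lower one along \<open>\<gamma>\<close> itself.\<close>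
  define U where "U = {y \<in> points S. \<Omega> y \<in> {\<Omega> p / r <..< r * \<Omega> p}}"
  have "openin (space_topology S) U"
    using \<Omega> openin_continuous_map_preimage[of "space_topology S" euclideanreal \<Omega> "{\<Omega> p / r <..< r * \<Omega> p}"]
    by (auto simp: conformal_factor_def U_def)
  moreover have "p \<in> U"
    using p \<Omega>p r by (auto simp: U_def divide_simps)
  ultimately have "neighbourhood (space_topology S) p U"
    by (auto simp: neighbourhood_def U_def)
  then obtain V where VU: "V \<subseteq> U" and V: "neighbourhood (space_topology S) p V"
    "\<And>a' b' \<eta>. causal_curve S {a'..b'} \<eta> \<Longrightarrow> \<eta> a' \<in> V \<Longrightarrow> \<eta> b' \<in> V \<Longrightarrow> \<eta> ` {a'..b'} \<subseteq> U"
    using quasi_strongly_causal_neighbourhood[OF _ p] by meson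
  obtain W where W: "openin (space_topology S) W" "p \<in> W" "W \<subseteq> V"
    using V(1) by (auto simp: neighbourhood_def)
  have "openin (top_of_set {a..b}) {u \<in> {a..b}. \<gamma> u \<in> W}"
    using openin_continuous_map_preimage[OF _ W(1), of "top_of_set {a..b}" \<gamma>] \<gamma>
    by (auto simp: causal_curve_def)
  then obtain d where d: "d > 0" "\<And>u. u \<in> {a..b} \<Longrightarrow> dist u x < d \<Longrightarrow> \<gamma> u \<in> W"
    using W(2) x unfolding openin_euclidean_subtopology_iff p_def by auto
  have "segment_weight (S\<lparr>time_sep := conformal_time_sep S \<Omega>\<rparr>) \<Theta> \<gamma> s t
      \<le> ennreal (r * r) * segment_weight S (\<lambda>x. \<Omega> x * \<Theta> x) \<gamma> s t"
    if st: "a \<le> s" "s < t" "t \<le> b" "x - d < s" "t < x + d" for s t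
  proof -
    have Vst: "\<gamma> s \<in> V" "\<gamma> t \<in> V"
      using d(2)[of s] d(2)[of t] st W(3) by (auto simp: dist_real_def)
    have U: "\<gamma> u \<in> U" if "u \<in> {s..t}" for u
    proof (cases "\<gamma> constant_on {s..t}")
      case True
      then have "\<gamma> u = \<gamma> s" using that st by (auto simp: constant_on_def)
      then show ?thesis using Vst VU by auto
    next
      case False
      then have "causal_curve S {s..t} \<gamma>"
        using st by (intro causal_curve_subinterval[OF \<gamma>]) auto
      then show ?thesis using V(2)[of s t \<gamma>] Vst that by auto
    qed
    let ?M = "SUP u\<in>{s..t}. \<Theta> (\<gamma> u)" and ?N = "SUP u\<in>{s..t}. \<Omega> (\<gamma> u) * \<Theta> (\<gamma> u)"
    have M0: "?M \<ge> 0"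
      using factor_SUP_pos[OF \<gamma> \<Theta>, of s t] st by auto
    have "?M \<le> r * ?N / \<Omega> p"
    proof (rule cSUP_least)
      fix u assume u: "u \<in> {s..t}"
      have "\<Omega> p \<le> r * \<Omega> (\<gamma> u)"
        using U[OF u] r by (simp add: U_def field_simps)
      then have "\<Omega> p * \<Theta> (\<gamma> u) \<le> r * \<Omega> (\<gamma> u) * \<Theta> (\<gamma> u)"
        using factor_pos[OF \<gamma> \<Theta>, of u] u st by (intro mult_right_mono) auto
      also have "\<dots> = r * (\<Omega> (\<gamma> u) * \<Theta> (\<gamma> u))" by simp
      also have "\<dots> \<le> r * ?N"
        using le_factor_SUP[OF \<gamma> \<Omega>\<Theta>, of s t u] u st r by (intro mult_left_mono) auto
      finally show "\<Theta> (\<gamma> u) \<le> r * ?N / \<Omega> p"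
        using \<Omega>p by (simp add: field_simps)
    qed (use st in auto)
    then have MN: "?M * (r * \<Omega> p) \<le> r * r * ?N"
      using \<Omega>p r by (simp add: field_simps)
    have "conformal_time_sep S \<Omega> (\<gamma> s) (\<gamma> t) \<le> ennreal (r * \<Omega> p) * time_sep S (\<gamma> s) (\<gamma> t)"
    proof (rule conformal_time_sep_le)
      fix a' b' \<eta> u assume "causal_curve_from_to S (\<gamma> s) (\<gamma> t) a' b' \<eta>" "u \<in> {a'..b'}"
      then have "\<eta> u \<in> U"
        using V(2)[of a' b' \<eta>] Vst by (auto simp: causal_curve_from_to_def)
      then show "\<Omega> (\<eta> u) \<le> r * \<Omega> p" by (simp add: U_def)
    qed
    then have "segment_weight (S\<lparr>time_sep := conformal_time_sep S \<Omega>\<rparr>) \<Theta> \<gamma> s t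
        \<le> ennreal ?M * (ennreal (r * \<Omega> p) * time_sep S (\<gamma> s) (\<gamma> t))"
      unfolding segment_weight_def by (auto intro: mult_left_mono)
    also have "\<dots> = ennreal (?M * (r * \<Omega> p)) * time_sep S (\<gamma> s) (\<gamma> t)"
      using M0 by (simp add: ennreal_mult' mult.assoc)
    also have "\<dots> \<le> ennreal (r * r * ?N) * time_sep S (\<gamma> s) (\<gamma> t)"
      using MN by (intro mult_right_mono ennreal_leI) auto
    also have "\<dots> = ennreal (r * r) * segment_weight S (\<lambda>x. \<Omega> x * \<Theta> x) \<gamma> s t"
      using r by (simp add: segment_weight_def ennreal_mult' mult.assoc)
    finally show ?thesis .
  qed
  with d(1) show ?thesis by blast
qed

text \<open>
  The record update replaces \<open>\<tau>\<close> by \<open>\<tau>\<^sub>\<Omega>\<close> and keeps everything else, in particular the causal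
  curves. This is the heart of the matter: conformal rescalings multiply at the level of lengths.
\<close>

lemma weighted_length_conformal_change:
  assumes \<gamma>: "causal_curve S {a..b} \<gamma>" and \<Omega>: "conformal_factor S \<Omega>" and \<Theta>: "conformal_factor S \<Theta>"
  shows "weighted_length (S\<lparr>time_sep := conformal_time_sep S \<Omega>\<rparr>) \<Theta> a b \<gamma>
    = weighted_length S (\<lambda>x. \<Omega> x * \<Theta> x) a b \<gamma>"
proof (rule antisym)
  note \<Omega>\<Theta> = conformal_factor_mult[OF \<Omega> \<Theta>]
  have ab: "a \<le> b"
    using \<gamma> by (cases "a \<le> b") (auto simp: causal_curve_def constant_on_def)
  show "weighted_length S (\<lambda>x. \<Omega> x * \<Theta> x) a b \<gamma>
      \<le> weighted_length (S\<lparr>time_sep := conformal_time_sep S \<Omega>\<rparr>) \<Theta> a b \<gamma>"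
    unfolding weighted_length_eq[of "S\<lparr>time_sep := conformal_time_sep S \<Omega>\<rparr>"]
  proof (rule subadditive_le_partition_inf[where g = "\<lambda>s t. weighted_length S (\<lambda>x. \<Omega> x * \<Theta> x) s t \<gamma>"])
    show "weighted_length S (\<lambda>x. \<Omega> x * \<Theta> x) a a \<gamma> = 0"
      by (simp add: weighted_length_eq)
    show "weighted_length S (\<lambda>x. \<Omega> x * \<Theta> x) a t \<gamma>
        \<le> weighted_length S (\<lambda>x. \<Omega> x * \<Theta> x) a s \<gamma> + weighted_length S (\<lambda>x. \<Omega> x * \<Theta> x) s t \<gamma>" for s t
      unfolding weighted_length_eq by (rule partition_inf_subadditive)
  qed (rule weighted_length_product_le_segment[OF \<gamma> \<Omega> \<Theta>])
  show "weighted_length (S\<lparr>time_sep := conformal_time_sep S \<Omega>\<rparr>) \<Theta> a b \<gamma>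
      \<le> weighted_length S (\<lambda>x. \<Omega> x * \<Theta> x) a b \<gamma>"
  proof (rule ennreal_le_if_le_mult_greater_1)
    fix r :: real assume r: "r > 1"
    have "weighted_length (S\<lparr>time_sep := conformal_time_sep S \<Omega>\<rparr>) \<Theta> a b \<gamma>
        \<le> partition_inf (\<lambda>s t. ennreal (r * r) * segment_weight S (\<lambda>x. \<Omega> x * \<Theta> x) \<gamma> s t) a b"
      unfolding weighted_length_eq
    proof (rule partition_inf_le_if_locally_le[OF ab])
      show "ennreal (r * r) * segment_weight S (\<lambda>x. \<Omega> x * \<Theta> x) \<gamma> s t
          + ennreal (r * r) * segment_weight S (\<lambda>x. \<Omega> x * \<Theta> x) \<gamma> t u
          \<le> ennreal (r * r) * segment_weight S (\<lambda>x. \<Omega> x * \<Theta> x) \<gamma> s u"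
        if "a \<le> s" "s < t" "t < u" "u \<le> b" for s t u
        using segment_weight_superadditive[OF \<gamma> \<Omega>\<Theta> that]
        by (simp add: mult_left_mono flip: distrib_left)
    qed (rule segment_weight_locally_le[OF \<gamma> \<Omega> \<Theta> \<Omega>\<Theta> _ _ r])
    also have "\<dots> = ennreal (r * r) * weighted_length S (\<lambda>x. \<Omega> x * \<Theta> x) a b \<gamma>"
      unfolding weighted_length_eq using r by (intro partition_inf_cmult) auto
    finally show "weighted_length (S\<lparr>time_sep := conformal_time_sep S \<Omega>\<rparr>) \<Theta> a b \<gamma>
        \<le> ennreal (r * r) * weighted_length S (\<lambda>x. \<Omega> x * \<Theta> x) a b \<gamma>" .
  qed
qed

lemma conformal_time_sep_eq_time_sep:
  assumes "p \<in> points S" "q \<in> points S" "\<And>x. x \<in> points S \<Longrightarrow> \<Omega> x = 1"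
  shows "conformal_time_sep S \<Omega> p q = time_sep S p q"
proof -
  have "weighted_length S \<Omega> a b \<gamma> = curve_length S a b \<gamma>" if "causal_curve_from_to S p q a b \<gamma>" for a b \<gamma>
    unfolding curve_length_def using that assms(3) causal_curve_in_points
    by (intro weighted_length_cong) (auto simp: causal_curve_from_to_def)
  then have "{weighted_length S \<Omega> a b \<gamma> | a b \<gamma>. causal_curve_from_to S p q a b \<gamma>}
      = {curve_length S a b \<gamma> | a b \<gamma>. causal_curve_from_to S p q a b \<gamma>}"
    by (intro Collect_cong) metis
  then show ?thesis
    using S assms(1,2) by (simp add: conformal_time_sep_def intrinsic_qsc_space_def intrinsic_def)
qed

end

section \<open>Transport along homeomorphisms\<close>

text \<open>
  Injectivity is what keeps the image curve non-constant, as the definition of causal curves demands.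
\<close>

lemma causal_curve_image:
  assumes \<gamma>: "causal_curve S I \<gamma>"
    and cont: "continuous_map (space_topology S) (space_topology S') f"
    and inj: "inj_on f (topspace (space_topology S))"
    and mono: "\<And>x y. x \<in> topspace (space_topology S) \<Longrightarrow> y \<in> topspace (space_topology S)
      \<Longrightarrow> causal S x y \<Longrightarrow> causal S' (f x) (f y)"
  shows "causal_curve S' I (f \<circ> \<gamma>)"
proof -
  have pts: "\<gamma> u \<in> topspace (space_topology S)" if "u \<in> I" for u
    using \<gamma> that continuous_map_image_subset_topspace[of "top_of_set I" "space_topology S" \<gamma>]
    by (auto simp: causal_curve_def)
  have "\<not> (f \<circ> \<gamma>) constant_on I"
  proof
    assume "(f \<circ> \<gamma>) constant_on I"
    then obtain c where c: "\<And>u. u \<in> I \<Longrightarrow> f (\<gamma> u) = c"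
      by (auto simp: constant_on_def)
    have "\<gamma> u = \<gamma> v" if "u \<in> I" "v \<in> I" for u v
      using inj pts[OF that(1)] pts[OF that(2)] c[OF that(1)] c[OF that(2)] by (simp add: inj_on_def)
    then have "\<gamma> constant_on I"
      unfolding constant_on_def by blast
    then show False using \<gamma> by (simp add: causal_curve_def)
  qed
  then show ?thesis
    using \<gamma> cont mono pts by (auto simp: causal_curve_def intro: continuous_map_compose)
qed

text \<open>
  The data behind a conformal relation, with the inverse homeomorphism \<open>g\<close> named so that it can serve
  as the witness for symmetry.
\<close>

definition conformal_map ::
    "'a lorentzian_space \<Rightarrow> 'b lorentzian_space \<Rightarrow> ('a \<Rightarrow> 'b) \<Rightarrow> ('b \<Rightarrow> 'a) \<Rightarrow> ('a \<Rightarrow> real) \<Rightarrow> bool" where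
  "conformal_map S S' f g \<Omega> \<longleftrightarrow>
     homeomorphic_maps (space_topology S) (space_topology S') f g \<and> conformal_factor S \<Omega> \<and>
     (\<forall>p\<in>points S. \<forall>q\<in>points S.
        (chron S p q \<longleftrightarrow> chron S' (f p) (f q)) \<and>
        (causal S p q \<longleftrightarrow> causal S' (f p) (f q)) \<and>
        time_sep S' (f p) (f q) = conformal_time_sep S \<Omega> p q)"

lemma conformally_related_iff:
  "conformally_related S S' \<longleftrightarrow> (\<exists>f g \<Omega>. conformal_map S S' f g \<Omega>)"
  unfolding conformally_related_def conformal_map_def homeomorphic_map_maps by blast

text \<open>
  The cocycle rule: composition with \<open>f\<close> matches the causal curves of the two spaces, and matching
  curves have equal lengths by \<open>weighted_length_conformal_change\<close>.
\<close>

lemma conformal_time_sep_transport: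
  assumes S: "intrinsic_qsc_space S" and S': "intrinsic_qsc_space S'"
    and f: "conformal_map S S' f g \<Omega>" and \<Omega>': "conformal_factor S' \<Omega>'"
    and pq: "p \<in> points S" "q \<in> points S"
  shows "conformal_time_sep S' \<Omega>' (f p) (f q) = conformal_time_sep S (\<lambda>x. \<Omega> x * \<Omega>' (f x)) p q"
proof -
  note [simp] = topspace_eq[OF S] topspace_eq[OF S']
  have maps: "continuous_map (space_topology S) (space_topology S') f"
      "continuous_map (space_topology S') (space_topology S) g"
    and gf: "\<And>x. x \<in> points S \<Longrightarrow> g (f x) = x" and fg: "\<And>y. y \<in> points S' \<Longrightarrow> f (g y) = y"
    using f by (auto simp: conformal_map_def homeomorphic_maps_def)
  have pts: "\<And>y. y \<in> points S' \<Longrightarrow> g y \<in> points S"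
    using continuous_map_image_subset_topspace[OF maps(2)] by auto
  have inj: "inj_on f (points S)" "inj_on g (points S')"
    by (rule inj_on_inverseI[of _ g], erule gf) (rule inj_on_inverseI[of _ f], erule fg)
  have \<Omega>: "conformal_factor S \<Omega>" and caus: "\<And>x y. x \<in> points S \<Longrightarrow> y \<in> points S \<Longrightarrow> causal S x y \<longleftrightarrow> causal S' (f x) (f y)"
    and ts: "\<And>x y. x \<in> points S \<Longrightarrow> y \<in> points S \<Longrightarrow> time_sep S' (f x) (f y) = conformal_time_sep S \<Omega> x y"
    using f by (auto simp: conformal_map_def)
  have \<Theta>: "conformal_factor S (\<lambda>x. \<Omega>' (f x))"
    using \<Omega>' maps(1) continuous_map_compose[OF maps(1), of euclideanreal \<Omega>']
      continuous_map_image_subset_topspace[OF maps(1)]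
    by (auto simp: conformal_factor_def o_def)
  have len: "weighted_length S' \<Omega>' a b (f \<circ> \<gamma>) = weighted_length S (\<lambda>x. \<Omega> x * \<Omega>' (f x)) a b \<gamma>"
    if "causal_curve S {a..b} \<gamma>" for a b \<gamma>
  proof -
    have "weighted_length S' \<Omega>' a b (f \<circ> \<gamma>)
        = weighted_length (S\<lparr>time_sep := conformal_time_sep S \<Omega>\<rparr>) (\<lambda>x. \<Omega>' (f x)) a b \<gamma>"
      using that by (intro weighted_length_cong) (auto simp: ts causal_curve_in_points[OF S])
    also have "\<dots> = weighted_length S (\<lambda>x. \<Omega> x * \<Omega>' (f x)) a b \<gamma>"
      by (rule weighted_length_conformal_change[OF S that \<Omega> \<Theta>])
    finally show ?thesis .
  qed
  have "{weighted_length S' \<Omega>' a b \<eta> | a b \<eta>. causal_curve_from_to S' (f p) (f q) a b \<eta>}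
      = {weighted_length S (\<lambda>x. \<Omega> x * \<Omega>' (f x)) a b \<gamma> | a b \<gamma>. causal_curve_from_to S p q a b \<gamma>}"
    (is "?L = ?R")
  proof (intro subset_antisym subsetI)
    fix z assume "z \<in> ?L"
    then obtain a b \<eta> where z: "z = weighted_length S' \<Omega>' a b \<eta>"
      and \<eta>: "causal_curve S' {a..b} \<eta>" "\<eta> a = f p" "\<eta> b = f q"
      by (auto simp: causal_curve_from_to_def)
    have \<gamma>: "causal_curve S {a..b} (g \<circ> \<eta>)"
      using \<eta>(1) maps(2) inj(2) caus pts fg by (intro causal_curve_image[of S']) auto
    have "weighted_length S' \<Omega>' a b \<eta> = weighted_length S' \<Omega>' a b (f \<circ> (g \<circ> \<eta>))"
      using \<eta>(1) by (intro weighted_length_cong) (auto simp: fg causal_curve_in_points[OF S'])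
    then have "z = weighted_length S (\<lambda>x. \<Omega> x * \<Omega>' (f x)) a b (g \<circ> \<eta>)"
      using len[OF \<gamma>] z by simp
    moreover have "causal_curve_from_to S p q a b (g \<circ> \<eta>)"
      using \<gamma> \<eta> gf pq by (simp add: causal_curve_from_to_def)
    ultimately show "z \<in> ?R" by blast
  next
    fix z assume "z \<in> ?R"
    then obtain a b \<gamma> where z: "z = weighted_length S (\<lambda>x. \<Omega> x * \<Omega>' (f x)) a b \<gamma>"
      and \<gamma>: "causal_curve S {a..b} \<gamma>" "\<gamma> a = p" "\<gamma> b = q"
      by (auto simp: causal_curve_from_to_def)
    have "causal_curve S' {a..b} (f \<circ> \<gamma>)"
      using \<gamma>(1) maps(1) inj(1) caus by (intro causal_curve_image[of S]) auto
    then have "causal_curve_from_to S' (f p) (f q) a b (f \<circ> \<gamma>)"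
      using \<gamma> by (simp add: causal_curve_from_to_def)
    moreover have "z = weighted_length S' \<Omega>' a b (f \<circ> \<gamma>)"
      using z len[OF \<gamma>(1)] by simp
    ultimately show "z \<in> ?L" by blast
  qed
  then show ?thesis by (simp add: conformal_time_sep_def)
qed

lemma conformally_related_refl:
  assumes S: "intrinsic_qsc_space S"
  shows "conformally_related S S"
proof -
  have "conformal_map S S id id (\<lambda>_. 1)"
    using conformal_time_sep_eq_time_sep[OF S]
    by (auto simp: conformal_map_def conformal_factor_def homeomorphic_maps_id)
  then show ?thesis
    by (auto simp: conformally_related_iff)
qed

text \<open>
  The inverse factor undoes the rescaling: the two together have weight \<open>1\<close>, and \<open>\<tau>\<^sub>1 = \<tau>\<close> in an
  intrinsic space.
\<close>

lemma conformally_related_sym: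
  assumes S: "intrinsic_qsc_space S" and S': "intrinsic_qsc_space S'" and "conformally_related S S'"
  shows "conformally_related S' S"
proof -
  obtain f g \<Omega> where f: "conformal_map S S' f g \<Omega>"
    using assms(3) by (auto simp: conformally_related_iff)
  note [simp] = topspace_eq[OF S] topspace_eq[OF S']
  have hom: "homeomorphic_maps (space_topology S) (space_topology S') f g" and \<Omega>: "conformal_factor S \<Omega>"
    using f by (auto simp: conformal_map_def)
  have g: "continuous_map (space_topology S') (space_topology S) g"
    and gf: "\<And>x. x \<in> points S \<Longrightarrow> g (f x) = x" and fg: "\<And>y. y \<in> points S' \<Longrightarrow> f (g y) = y"
    using hom by (auto simp: homeomorphic_maps_def)
  have pts: "\<And>y. y \<in> points S' \<Longrightarrow> g y \<in> points S"
    using continuous_map_image_subset_topspace[OF g] by auto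
  define \<Omega>' where "\<Omega>' = (\<lambda>y. inverse (\<Omega> (g y)))"
  have pos: "\<Omega> x > 0" if "x \<in> points S" for x
    using \<Omega> that by (auto simp: conformal_factor_def)
  have "continuous_map (space_topology S') euclideanreal (\<lambda>y. \<Omega> (g y))"
    using continuous_map_compose[OF g, of euclideanreal \<Omega>] \<Omega> by (simp add: o_def conformal_factor_def)
  then have "continuous_map (space_topology S') euclideanreal (\<lambda>y. inverse (\<Omega> (g y)))"
    using pos pts by (intro continuous_map_real_inverse) force+
  then have \<Omega>': "conformal_factor S' \<Omega>'"
    using pos pts by (simp add: conformal_factor_def \<Omega>'_def)
  have "time_sep S (g p) (g q) = conformal_time_sep S' \<Omega>' p q" if "p \<in> points S'" "q \<in> points S'" for p q
  proof -
    have "conformal_time_sep S' \<Omega>' p q = conformal_time_sep S' \<Omega>' (f (g p)) (f (g q))"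
      using that fg by simp
    also have "\<dots> = conformal_time_sep S (\<lambda>x. \<Omega> x * \<Omega>' (f x)) (g p) (g q)"
      using that pts by (intro conformal_time_sep_transport[OF S S' f \<Omega>'])
    also have "\<dots> = time_sep S (g p) (g q)"
    proof (rule conformal_time_sep_eq_time_sep[OF S])
      show "\<Omega> x * \<Omega>' (f x) = 1" if "x \<in> points S" for x
        using pos[OF that] that by (simp add: \<Omega>'_def gf)
    qed (use that pts in auto)
    finally show ?thesis by simp
  qed
  moreover have "homeomorphic_maps (space_topology S') (space_topology S) g f"
    using hom by (subst homeomorphic_maps_sym)
  ultimately have "conformal_map S' S g f \<Omega>'"
    using f \<Omega>' pts fg unfolding conformal_map_def by simp
  then show ?thesis
    by (auto simp: conformally_related_iff)
qed

lemma conformally_related_trans: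
  assumes S: "intrinsic_qsc_space S" and S': "intrinsic_qsc_space S'"
    and "conformally_related S S'" "conformally_related S' S''"
  shows "conformally_related S S''"
proof -
  obtain f g \<Omega> where f: "conformal_map S S' f g \<Omega>"
    using assms(3) by (auto simp: conformally_related_iff)
  obtain f' g' \<Omega>' where f': "conformal_map S' S'' f' g' \<Omega>'"
    using assms(4) by (auto simp: conformally_related_iff)
  note [simp] = topspace_eq[OF S] topspace_eq[OF S']
  have cont: "continuous_map (space_topology S) (space_topology S') f"
    using f by (auto simp: conformal_map_def homeomorphic_maps_def)
  have pts: "\<And>x. x \<in> points S \<Longrightarrow> f x \<in> points S'"
    using continuous_map_image_subset_topspace[OF cont] by auto
  have \<Omega>': "conformal_factor S' \<Omega>'"
    using f' by (simp add: conformal_map_def)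
  have "conformal_factor S (\<lambda>x. \<Omega>' (f x))"
    using \<Omega>' continuous_map_compose[OF cont, of euclideanreal \<Omega>'] pts
    by (auto simp: conformal_factor_def o_def)
  then have "conformal_factor S (\<lambda>x. \<Omega> x * \<Omega>' (f x))"
    using f by (intro conformal_factor_mult) (auto simp: conformal_map_def)
  moreover have "homeomorphic_maps (space_topology S) (space_topology S'') (f' \<circ> f) (g \<circ> g')"
    using f f' by (auto simp: conformal_map_def intro: homeomorphic_maps_compose)
  moreover have "time_sep S'' (f' (f p)) (f' (f q)) = conformal_time_sep S (\<lambda>x. \<Omega> x * \<Omega>' (f x)) p q"
    if "p \<in> points S" "q \<in> points S" for p q
    using f' pts that conformal_time_sep_transport[OF S S' f \<Omega>' that] by (simp add: conformal_map_def)
  ultimately have "conformal_map S S'' (f' \<circ> f) (g \<circ> g') (\<lambda>x. \<Omega> x * \<Omega>' (f x))"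
    using f f' pts by (simp add: conformal_map_def)
  then show ?thesis
    by (auto simp: conformally_related_iff)
qed

theorem theorem3p20:
  shows "(\<forall>S :: 'a lorentzian_space. intrinsic_qsc_space S \<longrightarrow> conformally_related S S) \<and>
    (\<forall>(S :: 'a lorentzian_space) (S' :: 'b lorentzian_space).
       intrinsic_qsc_space S \<longrightarrow> intrinsic_qsc_space S' \<longrightarrow>
       conformally_related S S' \<longrightarrow> conformally_related S' S) \<and>
    (\<forall>(S :: 'a lorentzian_space) (S' :: 'b lorentzian_space) (S'' :: 'c lorentzian_space).
       intrinsic_qsc_space S \<longrightarrow> intrinsic_qsc_space S' \<longrightarrow> intrinsic_qsc_space S'' \<longrightarrow>
       conformally_related S S' \<longrightarrow> conformally_related S' S'' \<longrightarrow> conformally_related S S'')"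
  by (intro conjI allI impI;
      (rule conformally_related_refl conformally_related_sym conformally_related_trans, assumption+))

end
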